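(* Let $0<\alpha<1$ and $\eta>0$. For a function $f$ of a real variable, the Fourier transform of the tempered Riesz fractional derivative of $f$ is $$\int_{-\infty}^{+\infty}e^{i\gamma x}\,\frac{\partial^{\alpha,\eta}f}{\partial|x|^\alpha}(x)\,dx=C_{\alpha,\eta}\,\hat F(\gamma)\,\frac{2|\gamma|}{(\eta^2+\gamma^2)^{\frac{1-\alpha}{2}}}\,\sin\left((1-\alpha)\arctan\frac{|\gamma|}{\eta}\right).$$
   Context: Here $\hat F(\gamma)=\int_{-\infty}^{+\infty}e^{i\gamma x}f(x)\,dx$ is the Fourier transform of $f$, and the tempered Riesz fractional derivative is $$\frac{\partial^{\alpha,\eta}f}{\partial|x|^\alpha}(x)=C_{\alpha,\eta}\left[\frac{d}{dx}\int_{-\infty}^x\frac{f(t)}{(x-t)^\alpha}\frac{e^{-\eta(x-t)}}{\Gamma(1-\alpha)}\,dt-\frac{d}{dx}\int_x^\infty\frac{f(t)}{(t-x)^\alpha}\frac{e^{-\eta(t-x)}}{\Gamma(1-\alpha)}\,dt\right],$$ where $C_{\alpha,\eta}$ is a suitable (normalizing) constant depending on $\alpha$ and $\eta$. *)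

theory Defs
  imports "HOL-Analysis.Analysis"
begin

text \<open>
  Functions of a real variable are complex-valued; a real-valued \<open>f\<close> is covered as
  \<open>\<lambda>x. complex_of_real (f x)\<close>. All integrals are Lebesgue (Bochner) integrals.
\<close>

definition fourier_transform :: "(real \<Rightarrow> complex) \<Rightarrow> real \<Rightarrow> complex" where
  "fourier_transform f \<gamma> = (LINT x|lebesgue. exp (\<i> * complex_of_real (\<gamma> * x)) * f x)"

text \<open>
  The endpoint \<open>t = x\<close>, where the kernel is singular, is a null set, so including it in the
  domain of integration is immaterial.
\<close>

definition tempered_left_integral ::
    "real \<Rightarrow> real \<Rightarrow> (real \<Rightarrow> complex) \<Rightarrow> real \<Rightarrow> complex" where
  "tempered_left_integral \<alpha> \<eta> f x =
     (LINT t:{..x}|lebesgue. f t / complex_of_real ((x - t) powr \<alpha>)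
        * complex_of_real (exp (- \<eta> * (x - t)) / Gamma (1 - \<alpha>)))"

definition tempered_right_integral ::
    "real \<Rightarrow> real \<Rightarrow> (real \<Rightarrow> complex) \<Rightarrow> real \<Rightarrow> complex" where
  "tempered_right_integral \<alpha> \<eta> f x =
     (LINT t:{x..}|lebesgue. f t / complex_of_real ((t - x) powr \<alpha>)
        * complex_of_real (exp (- \<eta> * (t - x)) / Gamma (1 - \<alpha>)))"

text \<open>
  The normalizing constant is an arbitrary function \<open>C\<close> of \<open>\<alpha>\<close> and \<open>\<eta>\<close>. The value is
  meaningful only where both one-sided integrals are differentiable.
\<close>

definition tempered_riesz_deriv ::
    "(real \<Rightarrow> real \<Rightarrow> real) \<Rightarrow> real \<Rightarrow> real \<Rightarrow> (real \<Rightarrow> complex) \<Rightarrow> real \<Rightarrow> complex" where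
  "tempered_riesz_deriv C \<alpha> \<eta> f x =
     complex_of_real (C \<alpha> \<eta>) *
       (vector_derivative (tempered_left_integral \<alpha> \<eta> f) (at x)
        - vector_derivative (tempered_right_integral \<alpha> \<eta> f) (at x))"

end

(*
  Both one-sided integrals are convolutions L = f * k and R = f * k(-.) with the integrable kernel
  k(s) = s^(-\<alpha>) exp(-\<eta> s) / Gamma(1 - \<alpha>) on s > 0, so the Fourier transform of G = L - R is the
  transform of f times k^(\<gamma>) - k^(-\<gamma>), where k^(\<gamma>) = (\<eta> - i \<gamma>)^(\<alpha> - 1); the difference is
  2 i Im k^(\<gamma>). The formula for k^ comes from the fact that the transform K_p of s^p exp(-\<eta> s)
  satisfies K_p' = i K_{p+1} and (\<eta> - i \<gamma>) K_{p+1} = (p + 1) K_p, so that (\<eta> - i \<gamma>)^(p+1) K_p(\<gamma>) is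
  constant, with value Gamma(p + 1) at \<gamma> = 0. Differentiation contributes the factor -i \<gamma>: there are no boundary terms because the
  derivative h of an integrable function H, if itself integrable, has integral 0. Indeed
  H(x + 1) - H(x) is the convolution of h with an indicator function of total mass 1, and its
  integral over x vanishes by translation invariance.
*)
theory Submission
  imports Defs
begin

section \<open>Convolutions and integrals of derivatives\<close>

text \<open>Translation and Fubini arguments run on \<open>lborel\<close>, while the hypotheses on
  \<open>f\<close> and on its Riesz derivative speak of the completion \<open>lebesgue\<close>. A
  Borel function equal almost everywhere bridges the two; it is assembled from Borel versions of the
  real and imaginary parts.\<close>

lemma lebesgue_integrable_borel_representative:
  fixes f :: "real \<Rightarrow> complex"
  assumes "integrable lebesgue f"
  obtains g where "integrable lborel g" "AE x in lborel. f x = g x"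
proof -
  have "(\<lambda>x. Re (f x)) \<in> borel_measurable lebesgue" "(\<lambda>x. Im (f x)) \<in> borel_measurable lebesgue"
    using borel_measurable_integrable[OF assms] by measurable
  then obtain u v where [measurable]: "u \<in> borel_measurable lborel" "v \<in> borel_measurable lborel"
    and ae: "AE x in lborel. Re (f x) = u x" "AE x in lborel. Im (f x) = v x"
    using completion_ex_borel_measurable_real[of _ lborel] by metis
  define g where "g = (\<lambda>x. Complex (u x) (v x))"
  have g_borel: "g \<in> borel_measurable lborel"
    by (subst borel_measurable_complex_iff) (simp add: g_def)
  have eq: "AE x in lborel. f x = g x"
    using ae by eventually_elim (simp add: g_def complex_eq_iff)
  have "integrable lebesgue g"
    using assms eq g_borel
    by (subst integrable_cong_AE[of _ _ f])
      (auto intro: AE_completion measurable_completion borel_measurable_integrable elim!: AE_mp)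
  then have "integrable lborel g"
    using g_borel by (simp add: integrable_completion)
  then show thesis
    using eq by (rule that)
qed

text \<open>Fubini for e^(i \<gamma> x) f(t) k(x - t), absolutely integrable because the character
  has modulus 1 and all translates of \<open>k\<close> have the same norm. In the inner integral the
  substitution x -> x + t splits the character into a factor in t and one in x.\<close>

lemma
  fixes f k :: "real \<Rightarrow> complex"
  assumes f: "integrable lborel f" and k: "integrable lborel k"
  shows integrable_convolution: "integrable lborel (\<lambda>x. LINT t|lborel. f t * k (x - t))"
    and fourier_convolution:
      "(LINT x|lborel. exp (\<i> * complex_of_real (\<gamma> * x)) * (LINT t|lborel. f t * k (x - t))) =
       (LINT x|lborel. exp (\<i> * complex_of_real (\<gamma> * x)) * f x) *
       (LINT x|lborel. exp (\<i> * complex_of_real (\<gamma> * x)) * k x)"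
proof -
  let ?e = "\<lambda>\<gamma> x. exp (\<i> * complex_of_real (\<gamma> * x))"
  note [measurable] = borel_measurable_integrable[OF f] borel_measurable_integrable[OF k]
  have shift: "(\<lambda>x. k (x - t)) = (\<lambda>x. k (-t + 1 * x))" for t
    by simp
  have k_shift: "integrable lborel (\<lambda>x. k (x - t))" for t
    unfolding shift by (rule lborel_integrable_real_affine[OF k]) simp
  have k_norm: "(LINT x|lborel. norm (k (x - t))) = (LINT x|lborel. norm (k x))" for t
    using lborel_integral_real_affine[of 1 "\<lambda>x. norm (k x)" "-t"] by simp
  have inner: "(LINT x|lborel. ?e \<gamma> x * (f t * k (x - t))) =
      ?e \<gamma> t * f t * (LINT x|lborel. ?e \<gamma> x * k x)" for \<gamma> t
  proof -
    have "(LINT x|lborel. ?e \<gamma> x * (f t * k (x - t))) =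
        (LINT x|lborel. ?e \<gamma> t * f t * (?e \<gamma> (-t + 1 * x) * k (-t + 1 * x)))"
      by (intro Bochner_Integration.integral_cong)
        (simp_all add: algebra_simps flip: exp_add)
    also have "\<dots> = ?e \<gamma> t * f t * (LINT x|lborel. ?e \<gamma> (-t + 1 * x) * k (-t + 1 * x))"
      by simp
    also have "(LINT x|lborel. ?e \<gamma> (-t + 1 * x) * k (-t + 1 * x)) = (LINT x|lborel. ?e \<gamma> x * k x)"
      using lborel_integral_real_affine[of 1 "\<lambda>x. ?e \<gamma> x * k x" "-t"] by simp
    finally show ?thesis .
  qed
  have prod: "integrable (lborel \<Otimes>\<^sub>M lborel) (\<lambda>(t, x). ?e \<gamma> x * (f t * k (x - t)))" for \<gamma>
  proof (rule lborel_pair.Fubini_integrable)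
    show "integrable lborel (\<lambda>t. LINT x|lborel. norm (case (t, x) of (t, x) \<Rightarrow> ?e \<gamma> x * (f t * k (x - t))))"
      using f by (simp add: norm_mult norm_exp_eq_Re k_norm)
    show "AE t in lborel. integrable lborel (\<lambda>x. case (t, x) of (t, x) \<Rightarrow> ?e \<gamma> x * (f t * k (x - t)))"
    proof (intro AE_I2)
      fix t
      have "integrable lborel (\<lambda>x. f t * k (x - t))"
        using k_shift by simp
      then show "integrable lborel (\<lambda>x. case (t, x) of (t, x) \<Rightarrow> ?e \<gamma> x * (f t * k (x - t)))"
        by (rule Bochner_Integration.integrable_bound) (auto simp: norm_mult norm_exp_eq_Re)
    qed
  qed measurable
  show "integrable lborel (\<lambda>x. LINT t|lborel. f t * k (x - t))"
    \<comment> \<open>At frequency 0 the character is 1, so \<open>prod\<close> is plain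
      integrability of f(t) k(x - t).\<close>
    using lborel_pair.integrable_snd[OF prod[of 0]] by simp
  have "(LINT x|lborel. ?e \<gamma> x * (LINT t|lborel. f t * k (x - t))) =
      (LINT x|lborel. LINT t|lborel. ?e \<gamma> x * (f t * k (x - t)))"
    by simp
  also have "\<dots> = (LINT t|lborel. LINT x|lborel. ?e \<gamma> x * (f t * k (x - t)))"
    by (rule lborel_pair.Fubini_integral[OF prod])
  also have "\<dots> = (LINT x|lborel. ?e \<gamma> x * f x) * (LINT x|lborel. ?e \<gamma> x * k x)"
    unfolding inner by simp
  finally show "(LINT x|lborel. ?e \<gamma> x * (LINT t|lborel. f t * k (x - t))) =
       (LINT x|lborel. ?e \<gamma> x * f x) * (LINT x|lborel. ?e \<gamma> x * k x)" .
qed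

text \<open>Serves as integration by parts without limits at infinity, once for the kernel and once
  for the Riesz derivative. The exceptional set admits the origin, where the kernel of exponent p +
  1 > 0 is continuous but need not be differentiable.\<close>

lemma integral_derivative_eq_0:
  fixes H h :: "real \<Rightarrow> complex"
  assumes H: "integrable lborel H" and h: "integrable lebesgue h"
    and cont: "continuous_on UNIV H" and S: "finite S"
    and deriv: "\<And>x. x \<notin> S \<Longrightarrow> (H has_vector_derivative h x) (at x)"
  shows "(LINT x|lebesgue. h x) = 0"
proof -
  obtain g where g: "integrable lborel g" and hg: "AE x in lborel. h x = g x"
    using lebesgue_integrable_borel_representative[OF h] .
  note [measurable] = borel_measurable_integrable[OF g]
  \<comment> \<open>For this window \<open>?k (x - t)\<close> is 1 exactly when x <= t <= x + 1, so
    convolving with it integrates over [x, x + 1].\<close>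
  let ?k = "\<lambda>x::real. complex_of_real (indicator {-1..0} x)"
  have k: "integrable lborel ?k"
    by (rule integrable_of_real) simp
  have ftc: "(LINT t|lborel. g t * ?k (x - t)) = H (x + 1) - H x" for x
  proof -
    have "(h has_integral H (x + 1) - H x) {x..x+1}"
      by (rule fundamental_theorem_of_calculus_strong[OF S])
        (auto intro: deriv has_vector_derivative_at_within continuous_on_subset[OF cont])
    \<comment> \<open>The fundamental theorem gives a gauge integral of \<open>h\<close>, which
      ignores the null set where \<open>h\<close> and \<open>g\<close> differ; integrability of
      \<open>g\<close> then makes it a Lebesgue integral.\<close>
    then have 1: "(g has_integral H (x + 1) - H x) {x..x+1}"
      using hg by (subst has_integral_AE[of _ _ h]) auto
    have "set_integrable lborel {x..x+1} g"
      unfolding set_integrable_def by (rule integrable_mult_indicator[OF _ g]) simp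
    with 1 have "H (x + 1) - H x = (LINT t:{x..x+1}|lborel. g t)"
      by (simp add: set_borel_integral_eq_integral(2) integral_unique)
    also have "\<dots> = (LINT t|lborel. g t * ?k (x - t))"
      unfolding set_lebesgue_integral_def
      by (rule Bochner_Integration.integral_cong) (auto simp: indicator_def)
    finally show ?thesis ..
  qed
  have shift: "(LINT x|lborel. H (x + 1)) = (LINT x|lborel. H x)" "integrable lborel (\<lambda>x. H (x + 1))"
    using lborel_integral_real_affine[of 1 H 1] lborel_integrable_real_affine[OF H, of 1 1]
    by (simp_all add: add.commute)
  have "(LINT x|lebesgue. h x) = (LINT x|lebesgue. g x)"
    using borel_measurable_integrable[OF h] hg
    by (intro integral_cong_AE AE_completion) (auto intro: measurable_completion)
  also have "\<dots> = (LINT x|lborel. g x)"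
    by (simp add: integral_completion)
  \<comment> \<open>Inserting the mass 1 of the window produces the right-hand side of the
    convolution formula at frequency 0.\<close>
  also have "\<dots> = (LINT x|lborel. g x) * (LINT x|lborel. ?k x)"
    by simp
  also have "\<dots> = (LINT x|lborel. LINT t|lborel. g t * ?k (x - t))"
    using fourier_convolution[OF g k, of 0] by simp
  also have "\<dots> = (LINT x|lborel. H (x + 1) - H x)"
    unfolding ftc ..
  also have "\<dots> = 0"
    using H shift by simp
  finally show ?thesis .
qed

section \<open>The tempered power kernel\<close>

text \<open>The exponent is kept general and the factor 1 / Gamma(1 - \<alpha>) left out, because
  the argument moves from p to p + 1 and p + 2.\<close>

definition tempered_kernel :: "real \<Rightarrow> real \<Rightarrow> real \<Rightarrow> real" where
  "tempered_kernel p \<eta> s = indicator {0<..} s * s powr p * exp (- \<eta> * s)"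

definition tempered_kernel_ft :: "real \<Rightarrow> real \<Rightarrow> real \<Rightarrow> complex" where
  "tempered_kernel_ft p \<eta> \<gamma> =
     (LINT s|lborel. exp (\<i> * complex_of_real (\<gamma> * s)) * complex_of_real (tempered_kernel p \<eta> s))"

lemma tempered_kernel_borel [measurable]: "tempered_kernel p \<eta> \<in> borel_measurable borel"
  unfolding tempered_kernel_def by measurable

lemma tempered_kernel_nonneg: "tempered_kernel p \<eta> s \<ge> 0"
  by (simp add: tempered_kernel_def)

lemma tempered_kernel_plus_1: "tempered_kernel (p + 1) \<eta> s = s * tempered_kernel p \<eta> s"
  by (simp add: tempered_kernel_def powr_add indicator_def)

text \<open>This is Euler's integral for Gamma(p + 1), available as a gauge integral; nonnegativity
  of the integrand turns it into a Lebesgue integral with the same value.\<close>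

lemma
  assumes "p > -1"
  shows integrable_tempered_kernel_1: "integrable lborel (tempered_kernel p 1)"
    and integral_tempered_kernel_1: "(LINT s|lborel. tempered_kernel p 1 s) = Gamma (p + 1)"
proof -
  have "((\<lambda>t. t powr (p + 1 - 1) / exp t) has_integral Gamma (p + 1)) {0..}"
    using assms by (intro Gamma_integral_real) simp
  then have "((\<lambda>t. if t \<in> {0..} then t powr p / exp t else 0) has_integral Gamma (p + 1)) UNIV"
    by (subst has_integral_restrict_UNIV) simp
  \<comment> \<open>The closed and the open half-line give the same function, since
    \<open>0 powr p\<close> is 0.\<close>
  also have "(\<lambda>t. if t \<in> {0..} then t powr p / exp t else 0) = tempered_kernel p 1"
    by (auto simp: fun_eq_iff tempered_kernel_def exp_minus divide_inverse split: split_indicator)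
  finally have hi: "(tempered_kernel p 1 has_integral Gamma (p + 1)) UNIV" .
  have nn: "(\<integral>\<^sup>+ s. ennreal (tempered_kernel p 1 s) \<partial>lborel) = ennreal (Gamma (p + 1))"
    using hi by (intro nn_integral_has_integral_lborel) (auto simp: tempered_kernel_nonneg)
  moreover have "Gamma (p + 1) \<ge> 0"
    using assms by (intro Gamma_real_nonneg) auto
  ultimately show "integrable lborel (tempered_kernel p 1)"
    "(LINT s|lborel. tempered_kernel p 1 s) = Gamma (p + 1)"
    by (auto intro!: integrableI_nn_integral_finite integral_eq_nn_integral
        simp: tempered_kernel_nonneg integral_eq_nn_integral)
qed

lemma
  assumes "p > -1" "\<eta> > 0"
  shows integrable_tempered_kernel: "integrable lborel (tempered_kernel p \<eta>)"
    and integral_tempered_kernel: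
      "(LINT s|lborel. tempered_kernel p \<eta> s) = Gamma (p + 1) / \<eta> powr (p + 1)"
proof -
  \<comment> \<open>Rescaling s -> \<eta> s reduces to rate 1. The form
    \<open>0 + \<eta> * s\<close> is the shape of the affine substitution rule, whose Jacobian
    raises the power of \<eta> from p to p + 1.\<close>
  have eq: "tempered_kernel p \<eta> s = tempered_kernel p 1 (0 + \<eta> * s) / \<eta> powr p" for s
    using \<open>\<eta> > 0\<close> by (auto simp: tempered_kernel_def powr_mult indicator_def zero_less_mult_iff)
  show "integrable lborel (tempered_kernel p \<eta>)"
    unfolding eq[abs_def] using assms integrable_tempered_kernel_1
    by (intro integrable_divide lborel_integrable_real_affine) auto
  have "Gamma (p + 1) = \<eta> * (LINT s|lborel. tempered_kernel p 1 (0 + \<eta> * s))"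
    using lborel_integral_real_affine[of \<eta> "tempered_kernel p 1" 0] assms integral_tempered_kernel_1[of p]
    by simp
  then show "(LINT s|lborel. tempered_kernel p \<eta> s) = Gamma (p + 1) / \<eta> powr (p + 1)"
    unfolding eq[abs_def] using assms by (simp add: powr_add)
qed

lemma integrable_tempered_kernel_complex:
  assumes "p > -1" "\<eta> > 0"
  shows "integrable lborel (\<lambda>s. complex_of_real (tempered_kernel p \<eta> s))"
  using integrable_tempered_kernel[OF assms] by (rule integrable_of_real)

lemma integrable_tempered_kernel_exp:
  assumes "p > -1" "\<eta> > 0"
  shows "integrable lborel (\<lambda>s. exp (\<i> * complex_of_real (\<gamma> * s)) * complex_of_real (tempered_kernel p \<eta> s))"
  by (rule Bochner_Integration.integrable_bound[OF integrable_tempered_kernel_complex[OF assms]])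
    (auto simp: norm_mult)

section \<open>Closed form of the Fourier transform of the kernel\<close>

lemma norm_exp_ii_minus_linear_le: "norm (exp (\<i> * complex_of_real x) - 1 - \<i> * x) \<le> x\<^sup>2"
  using Taylor_exp[of "\<i> * complex_of_real x" 1] by (simp add: norm_mult algebra_simps power2_eq_square)

lemma exp_ii_has_vector_derivative:
  "((\<lambda>x. exp (\<i> * complex_of_real (c * x))) has_vector_derivative
      \<i> * c * exp (\<i> * complex_of_real (c * x))) (at x)"
proof -
  have "((\<lambda>z. exp (\<i> * (complex_of_real c * z))) has_field_derivative
      \<i> * c * exp (\<i> * (complex_of_real c * complex_of_real x))) (at (complex_of_real x))"
    by (auto intro!: derivative_eq_intros)
  from has_vector_derivative_real_field[OF this] show ?thesis
    by simp
qed

text \<open>Integration by parts: on s > 0 the derivative of e^(i \<gamma> s) s^(p+1) e^(-\<eta> s)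
  is \<open>?h\<close>, in which both neighbouring kernels occur, and its integral over the line is
  0.\<close>

lemma tempered_kernel_ft_recursion:
  assumes "p > -1" "\<eta> > 0"
  shows "(\<eta> - \<i> * \<gamma>) * tempered_kernel_ft (p + 1) \<eta> \<gamma> = (p + 1) * tempered_kernel_ft p \<eta> \<gamma>"
proof -
  let ?k = "\<lambda>p s. exp (\<i> * complex_of_real (\<gamma> * s)) * complex_of_real (tempered_kernel p \<eta> s)"
  let ?h = "\<lambda>s. (p + 1) * ?k p s - (\<eta> - \<i> * \<gamma>) * ?k (p + 1) s"
  have p: "p + 1 > -1"
    using assms by simp
  note k = integrable_tempered_kernel_exp[OF assms, of \<gamma>] integrable_tempered_kernel_exp[OF p assms(2), of \<gamma>]
  have h: "integrable lborel ?h"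
    by (intro Bochner_Integration.integrable_diff integrable_mult_right k)
  have "continuous_on UNIV (tempered_kernel (p + 1) \<eta>)"
  proof -
    \<comment> \<open>Written with \<open>max s 0\<close>, continuity at the origin is visible, as
      the exponent p + 1 is positive.\<close>
    have "tempered_kernel (p + 1) \<eta> = (\<lambda>s. (max s 0) powr (p + 1) * exp (- \<eta> * s))"
      by (auto simp: tempered_kernel_def fun_eq_iff indicator_def)
    then show ?thesis
      using assms by (auto intro!: continuous_intros continuous_on_powr')
  qed
  then have cont: "continuous_on UNIV (?k (p + 1))"
    by (intro continuous_intros)
  have deriv: "(?k (p + 1) has_vector_derivative ?h s) (at s)" if "s \<notin> {0}" for s
  proof (cases "s > 0")
    case True
    have "((\<lambda>s. s powr (p + 1)) has_real_derivative (p + 1) * s powr (p + 1 - 1)) (at s)"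
      using True by (rule has_real_derivative_powr)
    moreover have "((\<lambda>s. exp (- \<eta> * s)) has_real_derivative exp (- \<eta> * s) * (- \<eta>)) (at s)"
      by (auto intro!: derivative_eq_intros)
    ultimately have "((\<lambda>s. s powr (p + 1) * exp (- \<eta> * s)) has_real_derivative
        (p + 1) * s powr (p + 1 - 1) * exp (- \<eta> * s) + exp (- \<eta> * s) * (- \<eta>) * s powr (p + 1)) (at s)"
      by (rule DERIV_mult)
    also have "(p + 1) * s powr (p + 1 - 1) * exp (- \<eta> * s) + exp (- \<eta> * s) * (- \<eta>) * s powr (p + 1) =
        (p + 1) * tempered_kernel p \<eta> s - \<eta> * tempered_kernel (p + 1) \<eta> s"
      using True by (simp add: tempered_kernel_def)
    finally have "(tempered_kernel (p + 1) \<eta> has_real_derivative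
        (p + 1) * tempered_kernel p \<eta> s - \<eta> * tempered_kernel (p + 1) \<eta> s) (at s)"
      by (rule has_field_derivative_transform_within_open[where S = "{0<..}"])
        (use True in \<open>auto simp: tempered_kernel_def\<close>)
    then have "((\<lambda>s. complex_of_real (tempered_kernel (p + 1) \<eta> s)) has_vector_derivative
        complex_of_real ((p + 1) * tempered_kernel p \<eta> s - \<eta> * tempered_kernel (p + 1) \<eta> s)) (at s)"
      by (rule has_vector_derivative_of_real)
    moreover have "((\<lambda>s. exp (\<i> * complex_of_real (\<gamma> * s))) has_vector_derivative
        \<i> * \<gamma> * exp (\<i> * complex_of_real (\<gamma> * s))) (at s)"
      by (rule exp_ii_has_vector_derivative)
    ultimately have "(?k (p + 1) has_vector_derivative
        exp (\<i> * complex_of_real (\<gamma> * s)) *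
          complex_of_real ((p + 1) * tempered_kernel p \<eta> s - \<eta> * tempered_kernel (p + 1) \<eta> s) +
        \<i> * \<gamma> * exp (\<i> * complex_of_real (\<gamma> * s)) * complex_of_real (tempered_kernel (p + 1) \<eta> s)) (at s)"
      by (rule has_vector_derivative_mult[rotated])
    then show ?thesis
      by (rule has_vector_derivative_eq_rhs) (simp only: of_real_diff of_real_mult of_real_add of_real_1, algebra)
  next
    case False
    with that have s: "s < 0" by simp
    have "((\<lambda>_. 0) has_vector_derivative 0) (at s)" by simp
    then have "(?k (p + 1) has_vector_derivative 0) (at s)"
      by (rule has_vector_derivative_transform_within_open[where S = "{..<0}"])
        (use s in \<open>auto simp: tempered_kernel_def\<close>)
    then show ?thesis
      using s by (simp add: tempered_kernel_def)
  qed
  have "integrable lebesgue ?h"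
    by (rule iffD2[OF integrable_completion[OF borel_measurable_integrable[OF h]] h])
  then have "(LINT s|lebesgue. ?h s) = 0"
    using integral_derivative_eq_0[where H = "?k (p + 1)" and h = ?h and S = "{0}"] k(2) cont deriv
    by blast
  then have "(LINT s|lborel. ?h s) = 0"
    by (simp only: integral_completion[OF borel_measurable_integrable[OF h]])
  then show ?thesis
    using k by (simp add: tempered_kernel_ft_def)
qed

text \<open>Differentiation under the integral sign with an explicit error. Each factor s raises the
  exponent of the kernel by one, so the linear term of the exponential gives the transform for p +
  1, and the quadratic remainder gives (x - \<gamma>)^2 times the mass \<open>M\<close> of the
  kernel for p + 2.\<close>

lemma tempered_kernel_ft_has_vector_derivative:
  assumes "p > -1" "\<eta> > 0"
  shows "(tempered_kernel_ft p \<eta> has_vector_derivative \<i> * tempered_kernel_ft (p + 1) \<eta> \<gamma>) (at \<gamma>)"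
proof -
  let ?K = "tempered_kernel_ft p \<eta>"
  let ?D = "\<i> * tempered_kernel_ft (p + 1) \<eta> \<gamma>"
  let ?k = "\<lambda>p \<gamma> s. exp (\<i> * complex_of_real (\<gamma> * s)) * complex_of_real (tempered_kernel p \<eta> s)"
  define M where "M = (LINT s|lborel. tempered_kernel (p + 1 + 1) \<eta> s)"
  have k: "integrable lborel (?k p \<gamma>)" "integrable lborel (?k (p + 1) \<gamma>)" for \<gamma>
    using integrable_tempered_kernel_exp[of p \<eta> \<gamma>] integrable_tempered_kernel_exp[of "p + 1" \<eta> \<gamma>] assms
    by simp_all
  have bound: "norm (?K x - ?K \<gamma> - (x - \<gamma>) *\<^sub>R ?D) \<le> M * (x - \<gamma>)\<^sup>2" for x
  proof -
    have eq: "?K x - ?K \<gamma> - (x - \<gamma>) *\<^sub>R ?D =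
        (LINT s|lborel. ?k p x s - ?k p \<gamma> s - (x - \<gamma>) *\<^sub>R (\<i> * ?k (p + 1) \<gamma> s))"
      unfolding tempered_kernel_ft_def using k by simp
    have "norm (LINT s|lborel. ?k p x s - ?k p \<gamma> s - (x - \<gamma>) *\<^sub>R (\<i> * ?k (p + 1) \<gamma> s)) \<le>
        (LINT s|lborel. (x - \<gamma>)\<^sup>2 * tempered_kernel (p + 1 + 1) \<eta> s)"
    proof (rule Bochner_Integration.integral_norm_bound_integral)
      show "integrable lborel (\<lambda>s. (x - \<gamma>)\<^sup>2 * tempered_kernel (p + 1 + 1) \<eta> s)"
        using assms by (intro integrable_mult_right integrable_tempered_kernel) auto
      show "integrable lborel (\<lambda>s. ?k p x s - ?k p \<gamma> s - (x - \<gamma>) *\<^sub>R (\<i> * ?k (p + 1) \<gamma> s))"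
        using k by simp
      fix s
      have "?k p x s - ?k p \<gamma> s - (x - \<gamma>) *\<^sub>R (\<i> * ?k (p + 1) \<gamma> s) =
          ?k p \<gamma> s * (exp (\<i> * complex_of_real ((x - \<gamma>) * s)) - 1 - \<i> * complex_of_real ((x - \<gamma>) * s))"
        unfolding tempered_kernel_plus_1
        by (simp add: algebra_simps scaleR_conv_of_real flip: exp_add)
      \<comment> \<open>The factor exp(|Re z|) in the Taylor bound is 1 on the imaginary axis, so
        the remainder is at most the square for every real argument, hence for every s.\<close>
      also have "norm \<dots> \<le> tempered_kernel p \<eta> s * ((x - \<gamma>) * s)\<^sup>2"
        unfolding norm_mult using norm_exp_ii_minus_linear_le[of "(x - \<gamma>) * s"]
        by (simp add: tempered_kernel_nonneg mult_left_mono)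
      also have "\<dots> = (x - \<gamma>)\<^sup>2 * tempered_kernel (p + 1 + 1) \<eta> s"
        unfolding tempered_kernel_plus_1 by (simp add: power2_eq_square)
      finally show "norm (?k p x s - ?k p \<gamma> s - (x - \<gamma>) *\<^sub>R (\<i> * ?k (p + 1) \<gamma> s)) \<le>
          (x - \<gamma>)\<^sup>2 * tempered_kernel (p + 1 + 1) \<eta> s" .
    qed
    then show ?thesis
      unfolding eq by (simp only: integral_mult_right_zero M_def mult.commute)
  qed
  have "((\<lambda>x. norm (?K x - ?K \<gamma> - (x - \<gamma>) *\<^sub>R ?D) / norm (x - \<gamma>)) \<longlongrightarrow> 0) (at \<gamma>)"
  proof (rule tendsto_sandwich[where f = "\<lambda>_. 0" and h = "\<lambda>x. M * \<bar>x - \<gamma>\<bar>"])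
    show "((\<lambda>x. M * \<bar>x - \<gamma>\<bar>) \<longlongrightarrow> 0) (at \<gamma>)"
      by (auto intro!: tendsto_eq_intros)
    show "\<forall>\<^sub>F x in at \<gamma>. norm (?K x - ?K \<gamma> - (x - \<gamma>) *\<^sub>R ?D) / norm (x - \<gamma>) \<le> M * \<bar>x - \<gamma>\<bar>"
    proof (rule always_eventually, rule allI)
      fix x
      have "M * (x - \<gamma>)\<^sup>2 = M * \<bar>x - \<gamma>\<bar> * \<bar>x - \<gamma>\<bar>"
        by (simp add: power2_eq_square)
      \<comment> \<open>At x = \<gamma> the quotient is 0 by the convention for division by
        0.\<close>
      with bound[of x] show "norm (?K x - ?K \<gamma> - (x - \<gamma>) *\<^sub>R ?D) / norm (x - \<gamma>) \<le> M * \<bar>x - \<gamma>\<bar>"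
        by (cases "x = \<gamma>") (simp_all add: divide_le_eq)
    qed
  qed auto
  then show ?thesis
    unfolding has_vector_derivative_def has_derivative_iff_norm
    by (simp add: bounded_linear_scaleR_left)
qed

text \<open>Derivative rule and recursion combine into a linear differential equation in \<gamma>
  with integrating factor (\<eta> - i \<gamma>)^(p+1). At \<gamma> = 0 this factor cancels the power
  of \<eta> in the mass of the kernel and leaves Gamma(p + 1).\<close>

lemma tempered_kernel_ft_eq:
  assumes p: "p > -1" and \<eta>: "\<eta> > 0"
  shows "tempered_kernel_ft p \<eta> \<gamma> =
    complex_of_real (Gamma (p + 1)) * (\<eta> - \<i> * \<gamma>) powr (- complex_of_real (p + 1))"
proof -
  let ?w = "\<lambda>\<gamma>. complex_of_real \<eta> - \<i> * complex_of_real \<gamma>"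
  let ?q = "complex_of_real (p + 1)"
  let ?G = "\<lambda>\<gamma>. tempered_kernel_ft p \<eta> \<gamma> * ?w \<gamma> powr ?q"
  \<comment> \<open>The real part \<eta> > 0 keeps \<eta> - i \<gamma> off the branch cut of the
    principal power.\<close>
  have w: "?w \<gamma> \<notin> \<real>\<^sub>\<le>\<^sub>0" "?w \<gamma> \<noteq> 0" for \<gamma>
    using \<eta> by (auto simp: complex_nonpos_Reals_iff complex_eq_iff)
  have "(?G has_vector_derivative 0) (at \<gamma>)" for \<gamma>
  proof -
    have "((\<lambda>\<gamma>. ?w \<gamma> powr ?q) has_vector_derivative (?q * ?w \<gamma> powr (?q - 1) * (- \<i>))) (at \<gamma>)"
    proof (rule has_vector_derivative_real_field)
      show "((\<lambda>z. (complex_of_real \<eta> - \<i> * z) powr ?q) has_field_derivative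
          ?q * ?w \<gamma> powr (?q - 1) * (- \<i>)) (at (complex_of_real \<gamma>))"
        using w[of \<gamma>] by (auto intro!: derivative_eq_intros)
    qed
    from has_vector_derivative_mult[OF tempered_kernel_ft_has_vector_derivative[OF p \<eta>] this]
    have "(?G has_vector_derivative tempered_kernel_ft p \<eta> \<gamma> * (?q * ?w \<gamma> powr (?q - 1) * (- \<i>)) +
        \<i> * tempered_kernel_ft (p + 1) \<eta> \<gamma> * ?w \<gamma> powr ?q) (at \<gamma>)" .
    also have "?w \<gamma> powr ?q = ?w \<gamma> powr (?q - 1) * ?w \<gamma>"
      using w[of \<gamma>] by (simp add: powr_add)
    also have "tempered_kernel_ft p \<eta> \<gamma> * (?q * ?w \<gamma> powr (?q - 1) * (- \<i>)) +
        \<i> * tempered_kernel_ft (p + 1) \<eta> \<gamma> * (?w \<gamma> powr (?q - 1) * ?w \<gamma>) =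
        \<i> * ?w \<gamma> powr (?q - 1) * (?w \<gamma> * tempered_kernel_ft (p + 1) \<eta> \<gamma> - ?q * tempered_kernel_ft p \<eta> \<gamma>)"
      by (simp add: algebra_simps)
    also have "\<dots> = 0"
      using tempered_kernel_ft_recursion[OF p \<eta>, of \<gamma>] by simp
    finally show ?thesis .
  qed
  then have "?G \<gamma> = ?G 0"
    by (intro has_derivative_zero_unique_connected[of UNIV ?G])
      (auto simp: has_vector_derivative_def)
  also have "\<dots> = Gamma (p + 1)"
  proof -
    have "complex_of_real \<eta> powr ?q = complex_of_real (\<eta> powr (p + 1))"
      using \<eta> by (intro powr_of_real) simp
    then show ?thesis
      using integral_tempered_kernel[OF p \<eta>] \<eta> by (simp add: tempered_kernel_ft_def)
  qed
  finally have "tempered_kernel_ft p \<eta> \<gamma> * ?w \<gamma> powr ?q = complex_of_real (Gamma (p + 1))" .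
  moreover have "?w \<gamma> powr ?q \<noteq> 0"
    using w[of \<gamma>] by simp
  ultimately show ?thesis
    unfolding powr_minus by (simp only: divide_inverse[symmetric] eq_divide_eq not_False_eq_True if_True)
qed

text \<open>In polar form \<eta> - i \<gamma> has modulus sqrt(\<eta>^2 + \<gamma>^2) and, as \<eta>
  > 0, principal argument -arctan(\<gamma> / \<eta>). Replacing \<gamma> by -\<gamma> keeps the
  modulus of the power and flips its angle, so only the sine survives in the difference.\<close>

lemma tempered_kernel_ft_diff:
  assumes p: "p > -1" and \<eta>: "\<eta> > 0"
  shows "tempered_kernel_ft p \<eta> \<gamma> - tempered_kernel_ft p \<eta> (- \<gamma>) =
    2 * \<i> * complex_of_real (Gamma (p + 1) * (\<eta>\<^sup>2 + \<gamma>\<^sup>2) powr (- (p + 1) / 2) * sin ((p + 1) * arctan (\<gamma> / \<eta>)))"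
proof -
  let ?w = "\<lambda>\<gamma>. complex_of_real \<eta> - \<i> * complex_of_real \<gamma>"
  have w: "?w \<gamma> \<noteq> 0" "norm (?w \<gamma>) = sqrt (\<eta>\<^sup>2 + \<gamma>\<^sup>2)" "Im (Ln (?w \<gamma>)) = - arctan (\<gamma> / \<eta>)" for \<gamma>
    using \<eta> by (auto simp: complex_eq_iff cmod_def Im_Ln_eq arctan_minus)
  have pw: "?w \<gamma> powr (- complex_of_real (p + 1)) =
      complex_of_real ((\<eta>\<^sup>2 + \<gamma>\<^sup>2) powr (- (p + 1) / 2)) * cis ((p + 1) * arctan (\<gamma> / \<eta>))" for \<gamma>
  proof -
    \<comment> \<open>The logarithm of the square root supplies the 1/2 in the exponent.\<close>
    have "Re (Ln (?w \<gamma>)) = ln (\<eta>\<^sup>2 + \<gamma>\<^sup>2) / 2"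
      using w(1,2)[of \<gamma>] \<eta> by (simp add: ln_sqrt add_pos_nonneg)
    then have "- complex_of_real (p + 1) * Ln (?w \<gamma>) =
        complex_of_real (- (p + 1) / 2 * ln (\<eta>\<^sup>2 + \<gamma>\<^sup>2)) + \<i> * complex_of_real ((p + 1) * arctan (\<gamma> / \<eta>))"
      using w(3)[of \<gamma>] by (simp add: complex_eq_iff) (simp add: algebra_simps)
    \<comment> \<open>\<open>powr\<close> is 0 at base 0 by definition, so this base is excluded
      before unfolding it.\<close>
    moreover have "\<eta>\<^sup>2 + \<gamma>\<^sup>2 \<noteq> 0"
      using \<eta> by (simp add: sum_power2_eq_zero_iff)
    ultimately show ?thesis
      using w(1)[of \<gamma>] by (simp only: powr_def exp_add cis_conv_exp exp_of_real) simp
  qed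
  have cis_diff: "c * (complex_of_real r * cis \<phi>) - c * (complex_of_real r * cis (- \<phi>)) =
      2 * \<i> * (c * complex_of_real r * complex_of_real (sin \<phi>))" for c r \<phi>
    by (simp add: complex_eq_iff algebra_simps)
  show ?thesis
    unfolding tempered_kernel_ft_eq[OF assms] pw
    by (simp only: minus_divide_left[symmetric] arctan_minus mult_minus_right cis_diff of_real_mult power2_minus)
qed

section \<open>The tempered Riesz derivative\<close>

text \<open>Used with \<open>K\<close> a kernel for the one-sided integrals and with
  \<open>K\<close> a character for the transform of \<open>f\<close>.\<close>

lemma integral_lebesgue_mult_borel:
  fixes f g K :: "real \<Rightarrow> complex"
  assumes f: "f \<in> borel_measurable lebesgue" and g: "g \<in> borel_measurable lborel"
    and K: "K \<in> borel_measurable lborel" and eq: "AE x in lborel. f x = g x"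
  shows "(LINT x|lebesgue. K x * f x) = (LINT x|lborel. K x * g x)"
proof -
  have "(LINT x|lebesgue. K x * f x) = (LINT x|lebesgue. K x * g x)"
    using f measurable_completion[OF g] measurable_completion[OF K] AE_completion[OF eq]
    by (intro integral_cong_AE) auto
  also have "\<dots> = (LINT x|lborel. K x * g x)"
    using g K by (intro integral_completion) auto
  finally show ?thesis .
qed

text \<open>The support of the kernel encodes the moving domain of integration; on the right the
  kernel is reflected. Equality holds at every x: where the integrand is not integrable, both sides
  are 0 by convention.\<close>

lemma
  assumes f: "f \<in> borel_measurable lebesgue" and g: "g \<in> borel_measurable lborel"
    and eq: "AE t in lborel. f t = g t"
  shows tempered_left_integral_eq_convolution: "tempered_left_integral \<alpha> \<eta> f x =
      (LINT t|lborel. g t * complex_of_real (tempered_kernel (- \<alpha>) \<eta> (x - t))) / Gamma (1 - \<alpha>)"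
    and tempered_right_integral_eq_convolution: "tempered_right_integral \<alpha> \<eta> f x =
      (LINT t|lborel. g t * complex_of_real (tempered_kernel (- \<alpha>) \<eta> (- (x - t)))) / Gamma (1 - \<alpha>)"
proof -
  let ?k = "\<lambda>s. complex_of_real (tempered_kernel (- \<alpha>) \<eta> s)"
  have [measurable]: "(\<lambda>t. ?k (x - t)) \<in> borel_measurable lborel"
    "(\<lambda>t. ?k (- (x - t))) \<in> borel_measurable lborel"
    by measurable
  \<comment> \<open>At t = x the integrands agree too: \<open>0 powr \<alpha>\<close> is 0, division
    by 0 gives 0, and the kernel vanishes at 0.\<close>
  have "tempered_left_integral \<alpha> \<eta> f x = (LINT t|lebesgue. ?k (x - t) * f t / Gamma (1 - \<alpha>))"
    unfolding tempered_left_integral_def set_lebesgue_integral_def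
    by (intro Bochner_Integration.integral_cong)
      (auto simp: tempered_kernel_def powr_minus divide_inverse split: split_indicator)
  also have "\<dots> = (LINT t|lborel. ?k (x - t) * g t) / Gamma (1 - \<alpha>)"
    using f g eq by (simp add: integral_lebesgue_mult_borel)
  finally show "tempered_left_integral \<alpha> \<eta> f x =
      (LINT t|lborel. g t * ?k (x - t)) / Gamma (1 - \<alpha>)"
    by (simp add: mult.commute)
  have "tempered_right_integral \<alpha> \<eta> f x = (LINT t|lebesgue. ?k (- (x - t)) * f t / Gamma (1 - \<alpha>))"
    unfolding tempered_right_integral_def set_lebesgue_integral_def
    by (intro Bochner_Integration.integral_cong)
      (auto simp: tempered_kernel_def powr_minus divide_inverse split: split_indicator)
  also have "\<dots> = (LINT t|lborel. ?k (- (x - t)) * g t) / Gamma (1 - \<alpha>)"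
    using f g eq by (simp only: integral_divide_zero integral_lebesgue_mult_borel)
      (simp add: integral_lebesgue_mult_borel)
  finally show "tempered_right_integral \<alpha> \<eta> f x =
      (LINT t|lborel. g t * ?k (- (x - t))) / Gamma (1 - \<alpha>)"
    by (simp add: mult.commute)
qed

text \<open>With e the character, the product rule gives i \<gamma> e G + e G' as the derivative of
  e G, and the integral of this derivative over the line vanishes.\<close>

lemma fourier_transform_derivative:
  fixes G G' :: "real \<Rightarrow> complex"
  assumes G: "integrable lborel G" and G': "integrable lebesgue G'"
    and deriv: "\<And>x. (G has_vector_derivative G' x) (at x)"
  shows "fourier_transform G' \<gamma> =
    - \<i> * \<gamma> * (LINT x|lborel. exp (\<i> * complex_of_real (\<gamma> * x)) * G x)"
proof -
  let ?e = "\<lambda>x. exp (\<i> * complex_of_real (\<gamma> * x))"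
  note [measurable] = borel_measurable_integrable[OF G]
  have e_borel: "?e \<in> borel_measurable lborel"
    by measurable
  have eG: "integrable lborel (\<lambda>x. ?e x * G x)"
    by (rule Bochner_Integration.integrable_bound[OF G]) (auto simp: norm_mult)
  then have eG_lebesgue: "integrable lebesgue (\<lambda>x. ?e x * G x)"
    by (subst integrable_completion) auto
  have eG': "integrable lebesgue (\<lambda>x. ?e x * G' x)"
    using measurable_completion[OF e_borel] borel_measurable_integrable[OF G']
    by (intro Bochner_Integration.integrable_bound[OF G']) (auto simp: norm_mult)
  have eG_deriv: "((\<lambda>x. ?e x * G x) has_vector_derivative (\<i> * \<gamma> * (?e x * G x) + ?e x * G' x)) (at x)" for x
  proof -
    have "(?e has_vector_derivative \<i> * \<gamma> * ?e x) (at x)"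
      by (rule exp_ii_has_vector_derivative)
    from has_vector_derivative_mult[OF this deriv] show ?thesis
      by (simp add: algebra_simps)
  qed
  have "(LINT x|lebesgue. \<i> * \<gamma> * (?e x * G x) + ?e x * G' x) = 0"
  \<comment> \<open>Differentiability everywhere leaves the exceptional set empty and supplies the
    continuity.\<close>
  proof (rule integral_derivative_eq_0[OF eG _ _ finite.emptyI eG_deriv])
    show "continuous_on UNIV (\<lambda>x. ?e x * G x)"
      using eG_deriv has_vector_derivative_continuous by (blast intro: continuous_at_imp_continuous_on)
    show "integrable lebesgue (\<lambda>x. \<i> * \<gamma> * (?e x * G x) + ?e x * G' x)"
      using eG_lebesgue eG' by (intro Bochner_Integration.integrable_add integrable_mult_right)
  qed
  then have "\<i> * \<gamma> * (LINT x|lebesgue. ?e x * G x) + fourier_transform G' \<gamma> = 0"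
    unfolding fourier_transform_def using eG_lebesgue eG' by simp
  moreover have "(LINT x|lebesgue. ?e x * G x) = (LINT x|lborel. ?e x * G x)"
    by (rule integral_completion) measurable
  ultimately show ?thesis
    by (simp add: eq_neg_iff_add_eq_0 add.commute)
qed

theorem mainTheorem4:
  fixes \<alpha> \<eta> \<gamma> :: real
    and C :: "real \<Rightarrow> real \<Rightarrow> real"
    and f :: "real \<Rightarrow> complex"
  assumes "0 < \<alpha>" and "\<alpha> < 1" and "\<eta> > 0"
    and "integrable lebesgue f"
    and "\<And>x. tempered_left_integral \<alpha> \<eta> f differentiable (at x)"
    and "\<And>x. tempered_right_integral \<alpha> \<eta> f differentiable (at x)"
    and "integrable lebesgue (tempered_riesz_deriv C \<alpha> \<eta> f)"
  shows "fourier_transform (tempered_riesz_deriv C \<alpha> \<eta> f) \<gamma> =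
    complex_of_real (C \<alpha> \<eta>) * fourier_transform f \<gamma> *
    complex_of_real (2 * \<bar>\<gamma>\<bar> / (\<eta>\<^sup>2 + \<gamma>\<^sup>2) powr ((1 - \<alpha>) / 2)
      * sin ((1 - \<alpha>) * arctan (\<bar>\<gamma>\<bar> / \<eta>)))"
proof (cases "C \<alpha> \<eta> = 0")
  \<comment> \<open>For C = 0 the integrability hypothesis says nothing about the bracket of
    derivatives, but both sides are 0. In the other case division by C recovers integrability of the
    bracket.\<close>
  case True
  then show ?thesis
    by (simp add: tempered_riesz_deriv_def fourier_transform_def)
next
  case C: False
  note \<alpha> = assms(1,2) and \<eta> = assms(3)
  note f = borel_measurable_integrable[OF assms(4)]
  let ?e = "\<lambda>\<gamma> x. exp (\<i> * complex_of_real (\<gamma> * x))"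
  let ?\<Gamma> = "complex_of_real (Gamma (1 - \<alpha>))"
  let ?L = "tempered_left_integral \<alpha> \<eta> f" and ?R = "tempered_right_integral \<alpha> \<eta> f"
  let ?k = "\<lambda>s. complex_of_real (tempered_kernel (- \<alpha>) \<eta> s)"
  let ?G = "\<lambda>x. ?L x - ?R x"
  let ?G' = "\<lambda>x. vector_derivative ?L (at x) - vector_derivative ?R (at x)"
  obtain g where g: "integrable lborel g" and fg: "AE x in lborel. f x = g x"
    using lebesgue_integrable_borel_representative[OF assms(4)] .
  note g_borel = borel_measurable_integrable[OF g]
  have k: "integrable lborel ?k"
    using \<alpha> \<eta> by (intro integrable_tempered_kernel_complex) auto
  have k_neg: "integrable lborel (\<lambda>s. ?k (- s))"
    using lborel_integrable_real_affine[OF k, of "-1" 0] by simp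
  have L: "?L = (\<lambda>x. (LINT t|lborel. g t * ?k (x - t)) / ?\<Gamma>)"
    using f g_borel fg by (intro ext tempered_left_integral_eq_convolution)
  have R: "?R = (\<lambda>x. (LINT t|lborel. g t * ?k (- (x - t))) / ?\<Gamma>)"
    using f g_borel fg by (intro ext tempered_right_integral_eq_convolution)
  have L_int: "integrable lborel ?L"
    unfolding L by (intro integrable_divide integrable_convolution g k)
  have R_int: "integrable lborel ?R"
    unfolding R by (intro integrable_divide integrable_convolution[OF g k_neg])
  have L_ft: "(LINT x|lborel. ?e \<gamma> x * ?L x) =
      (LINT x|lborel. ?e \<gamma> x * g x) * tempered_kernel_ft (- \<alpha>) \<eta> \<gamma> / ?\<Gamma>"
    using fourier_convolution[OF g k, of \<gamma>] by (simp add: L tempered_kernel_ft_def)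
  \<comment> \<open>The substitution x -> -x moves the reflection from the kernel to the
    frequency.\<close>
  have "(LINT x|lborel. ?e \<gamma> x * ?k (- x)) = tempered_kernel_ft (- \<alpha>) \<eta> (- \<gamma>)"
    using lborel_integral_real_affine[of "-1" "\<lambda>x. ?e \<gamma> x * ?k (- x)" 0]
    by (simp add: tempered_kernel_ft_def)
  then have R_ft: "(LINT x|lborel. ?e \<gamma> x * ?R x) =
      (LINT x|lborel. ?e \<gamma> x * g x) * tempered_kernel_ft (- \<alpha>) \<eta> (- \<gamma>) / ?\<Gamma>"
    using fourier_convolution[OF g k_neg, of \<gamma>] by (simp add: R)
  have g_ft: "(LINT x|lborel. ?e \<gamma> x * g x) = fourier_transform f \<gamma>"
    unfolding fourier_transform_def
    by (rule integral_lebesgue_mult_borel[symmetric, OF f g_borel _ fg]) measurable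
  have e_int: "integrable lborel (\<lambda>x. ?e \<gamma> x * h x)" if "integrable lborel h" for h :: "real \<Rightarrow> complex"
    using borel_measurable_integrable[OF that]
    by (intro Bochner_Integration.integrable_bound[OF that]) (auto simp: norm_mult)
  have "Gamma (1 - \<alpha>) > 0"
    using \<alpha> by (intro Gamma_real_pos) simp
  then have \<Gamma>: "?\<Gamma> \<noteq> 0"
    by simp
  have "(LINT x|lborel. ?e \<gamma> x * ?G x) = (LINT x|lborel. ?e \<gamma> x * ?L x) - (LINT x|lborel. ?e \<gamma> x * ?R x)"
    using e_int[OF L_int] e_int[OF R_int] by (simp add: right_diff_distrib)
  also have "\<dots> = fourier_transform f \<gamma> *
      (tempered_kernel_ft (- \<alpha>) \<eta> \<gamma> - tempered_kernel_ft (- \<alpha>) \<eta> (- \<gamma>)) / ?\<Gamma>"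
    unfolding L_ft R_ft g_ft by (simp add: diff_divide_distrib right_diff_distrib)
  also have "tempered_kernel_ft (- \<alpha>) \<eta> \<gamma> - tempered_kernel_ft (- \<alpha>) \<eta> (- \<gamma>) = 2 * \<i> * complex_of_real
      (Gamma (1 - \<alpha>) * (\<eta>\<^sup>2 + \<gamma>\<^sup>2) powr (- (1 - \<alpha>) / 2) * sin ((1 - \<alpha>) * arctan (\<gamma> / \<eta>)))"
    using tempered_kernel_ft_diff[of "- \<alpha>" \<eta> \<gamma>] \<alpha> \<eta> by simp
  finally have G_ft: "(LINT x|lborel. ?e \<gamma> x * ?G x) = fourier_transform f \<gamma> * (2 * \<i> * complex_of_real
      ((\<eta>\<^sup>2 + \<gamma>\<^sup>2) powr (- (1 - \<alpha>) / 2) * sin ((1 - \<alpha>) * arctan (\<gamma> / \<eta>))))"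
    using \<Gamma> by simp
  have G': "integrable lebesgue ?G'"
    using integrable_mult_right[OF assms(7), of "1 / complex_of_real (C \<alpha> \<eta>)"] C
    by (simp add: tempered_riesz_deriv_def)
  have deriv: "(?G has_vector_derivative ?G' x) (at x)" for x
    using assms(5,6) by (intro has_vector_derivative_diff) (auto simp flip: vector_derivative_works)
  \<comment> \<open>The factor -i \<gamma> from differentiation meets the 2 i of the difference of
    transforms; their product 2 \<gamma> is real.\<close>
  have algebraic: "- \<i> * complex_of_real c * (F * (2 * \<i> * complex_of_real X)) = F * complex_of_real (2 * c * X)"
    for c F X
    by (simp add: complex_eq_iff)
  have C_G': "fourier_transform (tempered_riesz_deriv C \<alpha> \<eta> f) \<gamma> = C \<alpha> \<eta> * fourier_transform ?G' \<gamma>"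
    unfolding fourier_transform_def tempered_riesz_deriv_def
    by (simp add: mult.left_commute flip: integral_mult_right_zero)
  have ft_G': "fourier_transform ?G' \<gamma> = fourier_transform f \<gamma> * complex_of_real
      (2 * \<gamma> * ((\<eta>\<^sup>2 + \<gamma>\<^sup>2) powr (- (1 - \<alpha>) / 2) * sin ((1 - \<alpha>) * arctan (\<gamma> / \<eta>))))"
    unfolding fourier_transform_derivative[OF Bochner_Integration.integrable_diff[OF L_int R_int] G' deriv] G_ft
    by (rule algebraic)
  \<comment> \<open>Both \<gamma> and the sine of the scaled arctangent are odd, so their product is
    even and \<gamma> may be replaced by its absolute value.\<close>
  have even: "2 * \<gamma> * ((\<eta>\<^sup>2 + \<gamma>\<^sup>2) powr (- (1 - \<alpha>) / 2) * sin ((1 - \<alpha>) * arctan (\<gamma> / \<eta>))) =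
      2 * \<bar>\<gamma>\<bar> / (\<eta>\<^sup>2 + \<gamma>\<^sup>2) powr ((1 - \<alpha>) / 2) * sin ((1 - \<alpha>) * arctan (\<bar>\<gamma>\<bar> / \<eta>))"
  proof -
    have "(\<eta>\<^sup>2 + \<gamma>\<^sup>2) powr (- (1 - \<alpha>) / 2) = inverse ((\<eta>\<^sup>2 + \<gamma>\<^sup>2) powr ((1 - \<alpha>) / 2))"
      by (simp only: minus_divide_left[symmetric] powr_minus)
    moreover have "\<bar>\<gamma>\<bar> * sin ((1 - \<alpha>) * arctan (\<bar>\<gamma>\<bar> / \<eta>)) = \<gamma> * sin ((1 - \<alpha>) * arctan (\<gamma> / \<eta>))"
      by (cases "\<gamma> < 0") (simp_all add: arctan_minus)
    ultimately show ?thesis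
      unfolding divide_inverse[of "2 * \<bar>\<gamma>\<bar>"] by algebra
  qed
  show ?thesis
    unfolding C_G' ft_G' even by (simp only: mult.assoc)
qed

end
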